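(* Let $0<r<1$ and let $\tau>\tau^*>1$. Let $k(\delta)$ be determined by the discrepancy principle $$k(\delta)=\min\{k\in\mathbb{N}:\ \|Ax_k^\delta-y^\delta\|\le\tau\delta\}$$ applied to the stochastic gradient descent iterates $x_k^\delta$ described in the context. Set $$c_p=\Big(\frac{(p+\frac12)(1-\alpha)}{c_0e(2^{1-\alpha}-1)}\Big)^{p+\frac12}\|w\|,\qquad c=\Big(\frac{\tau^*-1}{\sqrt n\,c_p}\Big)^{-\frac{2}{(1-\alpha)(\min(2p,r)+1)}}+2 .$$ Then $$\mathbb{P}\Big(k(\delta)\le c\,\delta^{-\frac{2}{(1-\alpha)(\min(2p,r)+1)}}\Big)\to1\quad\text{as }\delta\to0^+.$$
   Context: Setting. $\mathbb{N}=\{1,2,\dots\}$; $\|\cdot\|$ is the Euclidean norm on vectors and $(\cdot,\cdot)$ the Euclidean inner product. $A\in\mathbb{R}^{n\times m}$ is a fixed (nonzero) matrix whose $i$-th row, viewed as a column vector, is $a_i\in\mathbb{R}^m$; $B=n^{-1}A^tA$, with powers $B^p$ defined by the functional calculus for symmetric positive semidefinite matrices. $y^\dagger\in\mathbb{R}^n$ is fixed exact data in the range of $A$, and $x^\dagger$ is the minimum-norm solution of $Ax=y^\dagger$. For each $\delta>0$, $y^\delta\in\mathbb{R}^n$ is (deterministic) noisy data with $\|y^\delta-y^\dagger\|=\delta$; limits $\delta\to0^+$ are along an arbitrary such family $(y^\delta)_{\delta>0}$. Stochastic gradient descent (SGD). Let $i_1,i_2,\dots$ be i.i.d. uniform on $\{1,\dots,n\}$.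 With $x_1^\delta=x_1=0$, $$x_{k+1}^\delta=x_k^\delta-\eta_k\big((a_{i_k},x_k^\delta)-y^\delta_{i_k}\big)a_{i_k},\quad k=1,2,\dots$$ $\mathbb{P}$ is the probability with respect to the random indices. Assumptions. (i) $\eta_j=c_0j^{-\alpha}$ with $\alpha\in(0,1)$ and $0<c_0\le(\max_{j=1,\dots,n}\|a_j\|^2)^{-1}$. (ii) There are $p>0$ and $w\in\mathbb{R}^m$ with $x^\dagger-x_1=B^pw$. Conventions. $k(\delta)=\infty$ if the set in its definition is empty. If $w=0$ (so $c_p=0$), the term $\big(\frac{\tau^*-1}{\sqrt n c_p}\big)^{-\frac{2}{(1-\alpha)(\min(2p,r)+1)}}$ is read as $0$. *)

theory Defs
  imports "HOL-Probability.Probability"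
begin

definition eigenspace :: "real^'m^'m \<Rightarrow> real \<Rightarrow> (real^'m) set" where
  "eigenspace B \<mu> = {v. B *v v = \<mu> *\<^sub>R v}"

definition eigenvalues :: "real^'m^'m \<Rightarrow> real set" where
  "eigenvalues B = {\<mu>. \<exists>v. v \<noteq> 0 \<and> B *v v = \<mu> *\<^sub>R v}"

text \<open>Functional calculus of a symmetric matrix through its spectral decomposition:
  \<open>f(B) = (\<Sum>\<mu>. f \<mu> * P\<^sub>\<mu>)\<close> over the eigenvalues \<open>\<mu>\<close>, where \<open>P\<^sub>\<mu>\<close>, the orthogonal projection
  onto the eigenspace of \<open>\<mu>\<close>, is the closest-point map.\<close>

definition matrix_fun :: "(real \<Rightarrow> real) \<Rightarrow> real^'m^'m \<Rightarrow> real^'m^'m" where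
  "matrix_fun f B =
     matrix (\<lambda>v. \<Sum>\<mu>\<in>eigenvalues B. f \<mu> *\<^sub>R closest_point (eigenspace B \<mu>) v)"

text \<open>For positive semidefinite \<open>B\<close> and \<open>p > 0\<close>; the kernel is mapped to 0 since \<open>0 powr p = 0\<close>.\<close>

definition matrix_powr :: "real^'m^'m \<Rightarrow> real \<Rightarrow> real^'m^'m" where
  "matrix_powr B p = matrix_fun (\<lambda>\<mu>. \<mu> powr p) B"

definition min_norm_solution :: "real^'m^'n \<Rightarrow> real^'n \<Rightarrow> real^'m \<Rightarrow> bool" where
  "min_norm_solution A y x \<longleftrightarrow>
     A *v x = y \<and> (\<forall>z. A *v z = y \<longrightarrow> norm x \<le> norm z)"

text \<open>The iterates are numbered from 1, with \<open>x1\<close> the starting point; the value at 0 is a dummy.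
  The arguments are step sizes, matrix, data, starting point and the sequence of row indices.\<close>

fun sgd :: "(nat \<Rightarrow> real) \<Rightarrow> real^'m^'n \<Rightarrow> real^'n \<Rightarrow> real^'m \<Rightarrow> (nat \<Rightarrow> 'n) \<Rightarrow> nat \<Rightarrow> real^'m" where
  "sgd \<eta> A y x1 i 0 = x1"
| "sgd \<eta> A y x1 i (Suc 0) = x1"
| "sgd \<eta> A y x1 i (Suc (Suc k)) =
     (let j = Suc k; x = sgd \<eta> A y x1 i j
      in x - (\<eta> j * (row (i j) A \<bullet> x - y $ i j)) *\<^sub>R row (i j) A)"

text \<open>The infimum of the empty set in \<^typ>\<open>enat\<close> is \<open>\<infinity>\<close>.\<close>

definition discrepancy_index ::
    "real^'m^'n \<Rightarrow> real^'n \<Rightarrow> real \<Rightarrow> real \<Rightarrow> (nat \<Rightarrow> real^'m) \<Rightarrow> enat" where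
  "discrepancy_index A y \<tau> \<delta> x =
     (INF k\<in>{k. 1 \<le> k \<and> norm (A *v x k - y) \<le> \<tau> * \<delta>}. enat k)"

text \<open>For the constants below, \<open>w = 0\<close> gives \<open>src_const p \<alpha> c0 w = 0\<close>.  Then \<open>t / 0 = 0\<close> and
  \<open>0 powr a = 0\<close>, so the first term of \<open>stop_const\<close> vanishes and its value is 2.\<close>

definition src_const :: "real \<Rightarrow> real \<Rightarrow> real \<Rightarrow> real^'m \<Rightarrow> real" where
  "src_const p \<alpha> c0 w =
     ((p + 1/2) * (1 - \<alpha>) / (c0 * exp 1 * (2 powr (1 - \<alpha>) - 1))) powr (p + 1/2) * norm w"

definition stop_const :: "nat \<Rightarrow> real \<Rightarrow> real \<Rightarrow> real \<Rightarrow> real \<Rightarrow> real \<Rightarrow> real" where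
  "stop_const n p \<alpha> r \<tau>s cp =
     ((\<tau>s - 1) / (sqrt (real n) * cp)) powr (- 2 / ((1 - \<alpha>) * (min (2 * p) r + 1))) + 2"

end

theory Submission
  imports Defs "HOL-Real_Asymp.Real_Asymp"
begin

text \<open>Since the number of unknowns is finite, \<open>A\<close> is bounded below on its row space, which contains
  all iterates.  Let \<open>u\<close> be the least squares solution for \<open>y\<^sup>\<delta>\<close> in the row space: its residual has
  norm at most \<open>\<delta>\<close> and is orthogonal to the range of \<open>A\<close>.  The orthogonality removes the cross term
  from the conditional mean square error of one step, so that
  \<open>E \<parallel>x\<^sub>k\<^sub>+\<^sub>1 - u\<parallel>\<^sup>2 \<le> (1 - \<kappa> \<eta>\<^sub>k) E \<parallel>x\<^sub>k - u\<parallel>\<^sup>2 + O(\<eta>\<^sub>k\<^sup>2 \<delta>\<^sup>2)\<close>.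
  Hence \<open>E \<parallel>x\<^sub>k - u\<parallel>\<^sup>2 \<le> O(exp (- C k\<^sup>1\<^sup>-\<^sup>\<alpha>)) + \<delta>\<^sup>2 o(1)\<close>, which is \<open>o(\<delta>\<^sup>2)\<close> along any \<open>k\<close> growing
  polynomially in \<open>1/\<delta>\<close>, and Markov's inequality shows that the discrepancy is at most
  \<open>\<delta> + (\<tau> - 1) \<delta>\<close> with probability tending to 1.\<close>

section \<open>Row space and least squares\<close>

definition row_space :: "real^'m^'n \<Rightarrow> (real^'m) set" where
  "row_space A = range (\<lambda>z. z v* A)"

lemma subspace_range_matrix: "subspace (range ((*v) M))" for M :: "real^'m^'n"
  by (simp add: linear_subspace_image)

lemma subspace_row_space: "subspace (row_space A)"
  using subspace_range_matrix[of "transpose A"] by (simp add: row_space_def)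

lemma row_in_row_space: "row j A \<in> row_space A"
proof -
  have "row j A = axis j 1 v* A"
    by (metis column_transpose matrix_vector_mult_basis transpose_matrix_vector)
  then show ?thesis by (simp add: row_space_def)
qed

text \<open>Two orthogonal splittings do it: \<open>y\<close> along the range of \<open>A\<close>,
  then a preimage of the projected data along the row space, whose other component lies in the
  kernel of \<open>A\<close>. The second conclusion is the normal equation.\<close>

lemma least_squares_solution:
  fixes A :: "real^'m^'n" and y :: "real^'n"
  obtains u where "u \<in> row_space A" "(y - A *v u) v* A = 0"
proof -
  obtain p s where p: "p \<in> span (range ((*v) A))" and s: "\<And>v. v \<in> span (range ((*v) A)) \<Longrightarrow> orthogonal s v"
    and y: "y = p + s"
    using orthogonal_subspace_decomp_exists by blast
  have "p \<in> range ((*v) A)"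
    using p by (simp only: span_eq_iff[THEN iffD2, OF subspace_range_matrix])
  then obtain x where x: "p = A *v x" by blast
  obtain u v where u: "u \<in> span (row_space A)"
    and v: "\<And>z. z \<in> span (row_space A) \<Longrightarrow> orthogonal v z" and xuv: "x = u + v"
    using orthogonal_subspace_decomp_exists by blast
  have "A *v v = 0"
  proof -
    have "(A *v v) \<bullet> (A *v v) = ((A *v v) v* A) \<bullet> v"
      by (simp add: dot_lmul_matrix)
    also have "\<dots> = 0"
      using v[OF span_base, of "(A *v v) v* A"] by (simp add: row_space_def orthogonal_def inner_commute)
    finally show ?thesis by simp
  qed
  then have Au: "A *v u = p"
    by (simp add: x xuv matrix_vector_right_distrib)
  have "s v* A = 0"
  proof -
    have "(s v* A) \<bullet> (s v* A) = s \<bullet> (A *v (s v* A))"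
      by (simp add: dot_lmul_matrix)
    also have "\<dots> = 0"
      using s[OF span_base] by (auto simp: orthogonal_def)
    finally show ?thesis by simp
  qed
  then have "(y - A *v u) v* A = 0"
    by (simp add: Au y)
  moreover have "u \<in> row_space A"
    using u by (simp only: span_eq_iff[THEN iffD2, OF subspace_row_space])
  ultimately show ?thesis using that by blast
qed

text \<open>\<open>A\<close> is injective on the row space, since \<open>v = z v* A\<close> gives
  \<open>v \<bullet> v = z \<bullet> (A *v v)\<close>; in finite dimension injectivity yields a
  lower bound.\<close>

lemma bounded_below_on_row_space:
  fixes A :: "real^'m^'n"
  obtains \<sigma> where "\<sigma> > 0" "\<And>v. v \<in> row_space A \<Longrightarrow> \<sigma> * norm v \<le> norm (A *v v)"
proof -
  have "v = 0" if v: "v \<in> row_space A" and 0: "A *v v = 0" for v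
  proof -
    obtain z where "v = z v* A" using v by (auto simp: row_space_def)
    then have "v \<bullet> v = z \<bullet> (A *v v)"
      by (metis dot_lmul_matrix)
    then show ?thesis using 0 by simp
  qed
  then have "\<exists>e>0. \<forall>x\<in>row_space A. norm (A *v x) \<ge> e * norm x"
    by (intro injective_imp_isometric)
       (auto simp: subspace_row_space closed_subspace matrix_vector_mul_bounded_linear)
  then show ?thesis using that by blast
qed

section \<open>One SGD step averaged over the rows\<close>

lemma matrix_mult_component_row: "(A *v x) $ j = row j A \<bullet> x"
  for A :: "real^'m^'n"
  by (simp add: matrix_vector_mul_component row_def)

lemma norm_sq_eq_sum: "(norm x)\<^sup>2 = (\<Sum>j\<in>UNIV. (x $ j)\<^sup>2)" for x :: "real^'n"
  by (simp add: power2_norm_eq_inner inner_vec_def power2_eq_square[of "x $ _"])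

text \<open>With \<open>e = x - u\<close> and \<open>s = y - A *v u\<close>, the summand is the
  squared error after a step that uses row \<open>j\<close>, so the left side is
  \<open>CARD('n)\<close> times the mean over a uniform row. Orthogonality of \<open>s\<close> to
  the range of \<open>A\<close> removes the cross term and leaves \<open>s\<close> only at order
  \<open>h\<^sup>2\<close>.\<close>

lemma sum_sgd_step_le:
  fixes A :: "real^'m^'n" and e :: "real^'m" and s :: "real^'n"
  assumes s: "s v* A = 0" and h: "0 \<le> h" "h * R \<le> 1"
    and R: "\<And>j. (norm (row j A))\<^sup>2 \<le> R"
  shows "(\<Sum>j\<in>UNIV. (norm (e - (h * (row j A \<bullet> e - s $ j)) *\<^sub>R row j A))\<^sup>2)
    \<le> CARD('n) * (norm e)\<^sup>2 - h * (norm (A *v e))\<^sup>2 + h\<^sup>2 * R * (norm s)\<^sup>2"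
proof -
  have orth: "(A *v e) \<bullet> s = 0"
    using dot_lmul_matrix[of s A e] s by (simp add: inner_commute)
  have step: "(norm (e - (h * (row j A \<bullet> e - s $ j)) *\<^sub>R row j A))\<^sup>2
    \<le> (norm e)\<^sup>2 - 2 * h * (((A *v e) $ j)\<^sup>2 - (A *v e) $ j * s $ j)
       + h\<^sup>2 * R * ((A *v e - s) $ j)\<^sup>2" for j
  proof -
    have "(norm (e - (h * (row j A \<bullet> e - s $ j)) *\<^sub>R row j A))\<^sup>2
       = (norm e)\<^sup>2 - 2 * h * (((A *v e) $ j)\<^sup>2 - (A *v e) $ j * s $ j)
         + h\<^sup>2 * ((A *v e - s) $ j)\<^sup>2 * (norm (row j A))\<^sup>2"
      unfolding power2_norm_eq_inner
      by (simp add: inner_diff inner_commute matrix_mult_component_row power2_eq_square algebra_simps)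
    moreover have "h\<^sup>2 * ((A *v e - s) $ j)\<^sup>2 * (norm (row j A))\<^sup>2 \<le> h\<^sup>2 * ((A *v e - s) $ j)\<^sup>2 * R"
      using R by (intro mult_left_mono) auto
    ultimately show ?thesis by (simp add: mult_ac)
  qed
  have "(\<Sum>j\<in>UNIV. (norm (e - (h * (row j A \<bullet> e - s $ j)) *\<^sub>R row j A))\<^sup>2)
    \<le> (\<Sum>j\<in>UNIV. (norm e)\<^sup>2 - 2 * h * (((A *v e) $ j)\<^sup>2 - (A *v e) $ j * s $ j)
       + h\<^sup>2 * R * ((A *v e - s) $ j)\<^sup>2)"
    by (rule sum_mono) (rule step)
  also have "\<dots> = CARD('n) * (norm e)\<^sup>2 - 2 * h * ((norm (A *v e))\<^sup>2 - (A *v e) \<bullet> s)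
       + h\<^sup>2 * R * (norm (A *v e - s))\<^sup>2"
    unfolding norm_sq_eq_sum[of "A *v e"] norm_sq_eq_sum[of "A *v e - s"] inner_vec_def inner_real_def
    by (simp add: sum.distrib sum_subtractf sum_distrib_left right_diff_distrib)
  also have "(norm (A *v e - s))\<^sup>2 = (norm (A *v e))\<^sup>2 + (norm s)\<^sup>2"
    using orth by (simp add: power2_norm_eq_inner inner_diff inner_commute)
  also have "CARD('n) * (norm e)\<^sup>2 - 2 * h * ((norm (A *v e))\<^sup>2 - (A *v e) \<bullet> s)
       + h\<^sup>2 * R * ((norm (A *v e))\<^sup>2 + (norm s)\<^sup>2)
      = CARD('n) * (norm e)\<^sup>2 - 2 * h * (norm (A *v e))\<^sup>2 + (h * R) * (h * (norm (A *v e))\<^sup>2)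
        + h\<^sup>2 * R * (norm s)\<^sup>2"
    by (simp add: orth power2_eq_square algebra_simps)
  \<comment> \<open>The second-order term costs at most one of the two copies of
    \<open>h * (norm (A *v e))\<^sup>2\<close>, because \<open>h * R \<le> 1\<close>.\<close>
  also have "\<dots> \<le> CARD('n) * (norm e)\<^sup>2 - h * (norm (A *v e))\<^sup>2 + h\<^sup>2 * R * (norm s)\<^sup>2"
    using mult_right_mono[OF h(2), of "h * (norm (A *v e))\<^sup>2"] h(1) by simp
  finally show ?thesis .
qed

section \<open>Expectations over finitely many random indices\<close>

text \<open>This adaptedness makes \<open>i k\<close> independent of the iterate numbered
  \<open>k\<close>, and every iterate a function of finitely many indices.\<close>

lemma sgd_cong:
  assumes "\<And>j. 1 \<le> j \<Longrightarrow> j < k \<Longrightarrow> i j = i' j"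
  shows "sgd \<eta> A y x1 i k = sgd \<eta> A y x1 i' k"
  using assms
  by (induction \<eta> A y x1 i k rule: sgd.induct) (auto simp: Let_def)

text \<open>The restricted index tuple lives in a finite discrete space, where every
  \<open>f\<close> is bounded and measurable.\<close>

lemma (in prob_space) integrable_finite_valued:
  fixes i :: "nat \<Rightarrow> 'a \<Rightarrow> 'n::finite" and f :: "(nat \<Rightarrow> 'n) \<Rightarrow> real"
  assumes "finite K" "\<And>k. k \<in> K \<Longrightarrow> i k \<in> M \<rightarrow>\<^sub>M count_space UNIV"
  shows "integrable M (\<lambda>\<omega>. f (\<lambda>k\<in>K. i k \<omega>))"
proof (rule integrable_const_bound)
  have "finite (K \<rightarrow>\<^sub>E (UNIV :: 'n set))"
    using assms(1) by (intro finite_PiE) auto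
  then show "AE \<omega> in M. norm (f (\<lambda>k\<in>K. i k \<omega>)) \<le> Max ((\<lambda>h. norm (f h)) ` (K \<rightarrow>\<^sub>E UNIV))"
    by (intro AE_I2 Max_ge) auto
  have "(\<lambda>\<omega>. \<lambda>k\<in>K. i k \<omega>) \<in> M \<rightarrow>\<^sub>M PiM K (\<lambda>_. count_space UNIV)"
    using assms(2) by (intro measurable_restrict)
  then have "(\<lambda>\<omega>. \<lambda>k\<in>K. i k \<omega>) \<in> M \<rightarrow>\<^sub>M count_space (K \<rightarrow>\<^sub>E UNIV)"
    using assms(1) by (simp add: count_space_PiM_finite)
  moreover have "f \<in> borel_measurable (count_space (K \<rightarrow>\<^sub>E UNIV))"
    by simp
  ultimately show "(\<lambda>\<omega>. f (\<lambda>k\<in>K. i k \<omega>)) \<in> borel_measurable M"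
    by (rule measurable_compose)
qed

text \<open>Serves as conditioning on the past. The indicators of \<open>i k \<omega> = j\<close>
  decompose the left integrand, each has mean \<open>1 / CARD('n)\<close>, and independence of the
  disjoint blocks \<open>{k}\<close> and \<open>K\<close> factorises every product.\<close>

lemma (in prob_space) expectation_fresh_uniform:
  fixes i :: "nat \<Rightarrow> 'a \<Rightarrow> 'n::finite" and g :: "'n \<Rightarrow> (nat \<Rightarrow> 'n) \<Rightarrow> real"
  assumes indep: "indep_vars (\<lambda>_. count_space UNIV) i I"
    and unif: "distr M (count_space UNIV) (i k) = uniform_count_measure UNIV"
    and K: "finite K" "K \<subseteq> I" "k \<in> I" "k \<notin> K"
  shows "expectation (\<lambda>\<omega>. g (i k \<omega>) (\<lambda>l\<in>K. i l \<omega>))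
    = (\<Sum>j\<in>UNIV. expectation (\<lambda>\<omega>. g j (\<lambda>l\<in>K. i l \<omega>))) / CARD('n)"
proof -
  have meas: "i l \<in> M \<rightarrow>\<^sub>M count_space UNIV" if "l \<in> I" for l
    using indep that unfolding indep_vars_def by auto
  have int2: "integrable M (\<lambda>\<omega>. g j (\<lambda>l\<in>K. i l \<omega>))" for j
    using K meas by (intro integrable_finite_valued) auto
  define ind where "ind j \<omega> = (if i k \<omega> = j then 1 else 0 :: real)" for j \<omega>
  have int1: "integrable M (ind j)" for j
    using integrable_finite_valued[of "{k}" i "\<lambda>h. if h k = j then 1 else 0"] K meas
    unfolding ind_def by simp
  have ind: "expectation (ind j) = 1 / CARD('n)" for j
  proof -
    have "expectation (ind j) = (\<integral>z. (if z = j then 1 else 0) \<partial>distr M (count_space UNIV) (i k))"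
      unfolding ind_def using meas K by (subst integral_distr) auto
    also have "\<dots> = 1 / CARD('n)"
      unfolding unif uniform_count_measure_def
      by (subst lebesgue_integral_point_measure_finite) (auto simp: sum_divide_distrib[symmetric])
    finally show ?thesis .
  qed
  have indep2: "indep_var borel (ind j) borel (\<lambda>\<omega>. g j (\<lambda>l\<in>K. i l \<omega>))" for j
  proof -
    have "indep_var (PiM {k} (\<lambda>_. count_space UNIV)) (\<lambda>\<omega>. \<lambda>l\<in>{k}. i l \<omega>)
        (PiM K (\<lambda>_. count_space UNIV)) (\<lambda>\<omega>. \<lambda>l\<in>K. i l \<omega>)"
      using K by (intro indep_var_restrict[OF indep]) auto
    then have "indep_var borel ((\<lambda>h. if h k = j then 1 else 0 :: real) \<circ> (\<lambda>\<omega>. \<lambda>l\<in>{k}. i l \<omega>))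
        borel (g j \<circ> (\<lambda>\<omega>. \<lambda>l\<in>K. i l \<omega>))"
      using K(1) by (intro indep_var_compose) (auto simp: count_space_PiM_finite)
    then show ?thesis
      by (simp add: o_def ind_def[abs_def])
  qed
  have "g (i k \<omega>) h = (\<Sum>j\<in>UNIV. ind j \<omega> * g j h)" for \<omega> h
    by (simp add: ind_def if_distrib[of "\<lambda>x. x * _"] cong: if_cong)
  then have "expectation (\<lambda>\<omega>. g (i k \<omega>) (\<lambda>l\<in>K. i l \<omega>))
    = (\<Sum>j\<in>UNIV. expectation (\<lambda>\<omega>. ind j \<omega> * g j (\<lambda>l\<in>K. i l \<omega>)))"
    using indep_var_integrable[OF indep2 int1 int2] by simp
  also have "\<dots> = (\<Sum>j\<in>UNIV. expectation (\<lambda>\<omega>. g j (\<lambda>l\<in>K. i l \<omega>))) / CARD('n)"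
    by (simp add: indep_var_lebesgue_integral[OF indep2 int1 int2] ind sum_divide_distrib)
  finally show ?thesis .
qed

section \<open>Scalar contraction recursions\<close>

text \<open>By linearity the bound separates the decay of the starting value from the forced part,
  which is \<open>d\<close> times the solution \<open>b\<close> for \<open>d = 1\<close>. With the
  squared residual as \<open>d\<close>, one sequence \<open>b\<close> serves all noise
  levels.\<close>

lemma unroll_contraction:
  fixes a t e b :: "nat \<Rightarrow> real"
  assumes a: "\<And>k. a (Suc k) \<le> (1 - t k) * a k + d * e k" and t: "\<And>k. t k \<le> 1"
    and b: "b 0 = 0" "\<And>k. b (Suc k) = (1 - t k) * b k + e k"
    and D: "a 0 \<le> D"
  shows "a k \<le> D * (\<Prod>j<k. 1 - t j) + d * b k"
proof (induction k)
  case (Suc k)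
  have "a (Suc k) \<le> (1 - t k) * a k + d * e k" by (rule a)
  also have "\<dots> \<le> (1 - t k) * (D * (\<Prod>j<k. 1 - t j) + d * b k) + d * e k"
    using Suc t[of k] by (intro add_right_mono mult_left_mono) auto
  also have "\<dots> = D * (\<Prod>j<Suc k. 1 - t j) + d * b (Suc k)"
    by (simp add: b algebra_simps)
  finally show ?case .
qed (use b D in simp)

lemma prod_one_minus_le_exp:
  fixes t :: "nat \<Rightarrow> real"
  assumes "\<And>j. t j \<le> 1" "finite S"
  shows "(\<Prod>j\<in>S. 1 - t j) \<le> exp (- (\<Sum>j\<in>S. t j))"
proof -
  have "(\<Prod>j\<in>S. 1 - t j) \<le> (\<Prod>j\<in>S. exp (- t j))"
    proof (rule prod_mono)
    fix j
    show "0 \<le> 1 - t j \<and> 1 - t j \<le> exp (- t j)"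
      using assms(1)[of j] exp_ge_add_one_self[of "- t j"] by simp
  qed
  also have "\<dots> = exp (- (\<Sum>j\<in>S. t j))"
    using assms(2) by (simp add: exp_sum sum_negf[symmetric])
  finally show ?thesis .
qed

text \<open>Each \<open>b (Suc k)\<close> is a convex combination of \<open>b k\<close> and
  \<open>e k\<close>. Once \<open>e\<close> stays below a level, the excess of \<open>b\<close> over
  it is damped by a product of factors \<open>1 - t j\<close>, which tends to 0 since the sum of the
  \<open>t j\<close> diverges.\<close>

lemma contraction_tendsto_0:
  fixes b t e :: "nat \<Rightarrow> real"
  assumes b: "\<And>k. b (Suc k) = (1 - t k) * b k + t k * e k"
    and t: "\<And>k. 0 \<le> t k" "\<And>k. t k \<le> 1" and e: "\<And>k. 0 \<le> e k" "e \<longlonglongrightarrow> 0"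
    and div: "filterlim (\<lambda>k. \<Sum>j<k. t j) at_top sequentially" and b0: "b 0 = 0"
  shows "b \<longlonglongrightarrow> 0"
proof -
  have nn: "0 \<le> b k" for k
    by (induction k) (auto simp: b b0 t e)
  show ?thesis
  proof (rule order_tendstoI)
    fix y :: real assume "y < 0"
    then show "\<forall>\<^sub>F k in sequentially. y < b k"
      using nn by (intro always_eventually) (auto intro: less_le_trans)
  next
    fix y :: real assume y: "0 < y"
    have "\<forall>\<^sub>F k in sequentially. e k < y / 2"
      using e(2) y by (intro order_tendstoD) auto
    then obtain K where K: "\<And>k. k \<ge> K \<Longrightarrow> e k < y / 2"
      by (auto simp: eventually_sequentially)
    have upper: "b (K + k) \<le> y / 2 + b K * exp (- (\<Sum>j<k. t (K + j)))" for k
    proof -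
      have "b (K + k) \<le> y / 2 + b K * (\<Prod>j<k. 1 - t (K + j))"
      proof (induction k)
        case (Suc k)
        have "b (K + Suc k) \<le> (1 - t (K + k)) * (y / 2 + b K * (\<Prod>j<k. 1 - t (K + j))) + t (K + k) * (y / 2)"
          unfolding add_Suc_right b using Suc K[of "K + k"] t
          by (intro add_mono mult_left_mono) auto
        then show ?case by (simp add: algebra_simps)
      qed (use y in simp)
      also have "\<dots> \<le> y / 2 + b K * exp (- (\<Sum>j<k. t (K + j)))"
        using nn prod_one_minus_le_exp[of "\<lambda>j. t (K + j)" "{..<k}"] t
        by (intro add_left_mono mult_left_mono) auto
      finally show ?thesis .
    qed
    \<comment> \<open>The shifted sums differ from the original ones by a constant, so they diverge
      as well.\<close>
    have split: "(\<Sum>j<k + K. t j) = (\<Sum>j<K. t j) + (\<Sum>j<k. t (K + j))" for k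
      by (induction k) (simp_all add: add.commute)
    have "filterlim (\<lambda>k. - (\<Sum>j<K. t j) + (\<Sum>j<k + K. t j)) at_top sequentially"
      by (rule filterlim_tendsto_add_at_top[OF tendsto_const])
         (rule filterlim_compose[OF div filterlim_add_const_nat_at_top])
    then have "filterlim (\<lambda>k. \<Sum>j<k. t (K + j)) at_top sequentially"
      by (simp add: split)
    then have "(\<lambda>k. exp (- (\<Sum>j<k. t (K + j)))) \<longlonglongrightarrow> 0"
      by (intro filterlim_compose[OF exp_at_bot]) (simp add: filterlim_uminus_at_top)
    then have "(\<lambda>k. y / 2 + b K * exp (- (\<Sum>j<k. t (K + j)))) \<longlonglongrightarrow> y / 2 + b K * 0"
      by (rule tendsto_add[OF tendsto_const tendsto_mult[OF tendsto_const]])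
    then have "\<forall>\<^sub>F k in sequentially. y / 2 + b K * exp (- (\<Sum>j<k. t (K + j))) < y"
      using y order_tendstoD(2)[of _ "y / 2 + b K * 0" _ y] by simp
    then have "\<forall>\<^sub>F k in sequentially. b (k + K) < y"
      by eventually_elim (use upper in \<open>auto simp: add.commute intro: le_less_trans\<close>)
    then show "\<forall>\<^sub>F k in sequentially. b k < y"
      by (rule eventually_sequentially_seg[THEN iffD1])
  qed
qed

section \<open>The discrepancy index as an event\<close>

text \<open>A nonempty set of naturals attains its infimum, and the empty set gives \<infinity>,
  which no real \<open>C\<close> bounds. The right side turns the event into a countable union, and
  a single good \<open>k\<close> establishes it.\<close>

lemma discrepancy_index_le_iff:
  "ereal_of_enat (discrepancy_index A y \<tau> \<delta> x) \<le> ereal C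
    \<longleftrightarrow> (\<exists>k\<ge>1. real k \<le> C \<and> norm (A *v x k - y) \<le> \<tau> * \<delta>)" (is "?L \<longleftrightarrow> ?R")
proof
  let ?S = "{k. 1 \<le> k \<and> norm (A *v x k - y) \<le> \<tau> * \<delta>}"
  assume L: ?L
  have "?S \<noteq> {}"
  proof
    assume "?S = {}"
    then have "discrepancy_index A y \<tau> \<delta> x = \<infinity>"
      by (simp only: discrepancy_index_def image_empty) (simp add: Inf_enat_def)
    with L show False by simp
  qed
  then have "discrepancy_index A y \<tau> \<delta> x \<in> enat ` ?S"
    unfolding discrepancy_index_def Inf_enat_def by (auto intro: LeastI)
  then show ?R using L by auto
next
  assume ?R
  then obtain k where k: "1 \<le> k" "real k \<le> C" "norm (A *v x k - y) \<le> \<tau> * \<delta>" by blast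
  then have "discrepancy_index A y \<tau> \<delta> x \<le> enat k"
    unfolding discrepancy_index_def by (intro INF_lower) auto
  then have "ereal_of_enat (discrepancy_index A y \<tau> \<delta> x) \<le> ereal_of_enat (enat k)"
    by (simp only: ereal_of_enat_le_iff)
  also have "\<dots> \<le> ereal C" using k by simp
  finally show ?L .
qed

section \<open>Mean square error of the iterates\<close>

text \<open>The index \<open>i k\<close> is fresh relative to the error at \<open>k\<close>, so
  \<open>sum_sgd_step_le\<close> can be averaged over the past. The error stays in the row space,
  where \<sigma> turns the decrease in terms of \<open>A *v e\<close> into a contraction of
  \<open>e\<close>.\<close>

lemma (in prob_space) sgd_error_step:
  fixes A :: "real^'m^'n" and y :: "real^'n" and x1 u :: "real^'m" and i :: "nat \<Rightarrow> 'a \<Rightarrow> 'n"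
  assumes indep: "indep_vars (\<lambda>_. count_space UNIV) i {1..}"
    and unif: "distr M (count_space UNIV) (i k) = uniform_count_measure UNIV"
    and ls: "(y - A *v u) v* A = 0"
    and u: "u \<in> row_space A" and x1: "x1 \<in> row_space A"
    and \<sigma>: "0 \<le> \<sigma>" "\<And>v. v \<in> row_space A \<Longrightarrow> \<sigma> * norm v \<le> norm (A *v v)"
    and R: "\<And>j. (norm (row j A))\<^sup>2 \<le> R" and \<eta>: "0 \<le> \<eta> k" "\<eta> k * R \<le> 1" and k: "1 \<le> k"
  defines "E \<equiv> \<lambda>l. expectation (\<lambda>\<omega>. (norm (sgd \<eta> A y x1 (\<lambda>j. i j \<omega>) l - u))\<^sup>2)"
  shows "E (Suc k) \<le> (1 - \<eta> k * \<sigma>\<^sup>2 / CARD('n)) * E k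
      + (\<eta> k)\<^sup>2 * R / CARD('n) * (norm (y - A *v u))\<^sup>2"
proof -
  define K where "K = {1..<k}"
  define e where "e h = sgd \<eta> A y x1 h k - u" for h
  define s where "s = y - A *v u"
  define g where "g j h = (norm (e h - (\<eta> k * (row j A \<bullet> e h - s $ j)) *\<^sub>R row j A))\<^sup>2" for j h
  let ?r = "\<lambda>\<omega>. \<lambda>j\<in>K. i j \<omega>"
  have meas: "i l \<in> M \<rightarrow>\<^sub>M count_space UNIV" if "l \<in> K" for l
    using indep that unfolding indep_vars_def K_def by auto
  have int: "integrable M (\<lambda>\<omega>. f (?r \<omega>))" for f :: "(nat \<Rightarrow> 'n) \<Rightarrow> real"
    using meas by (intro integrable_finite_valued) (auto simp: K_def)
  have s: "s v* A = 0"
    using ls unfolding s_def .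
  have e_restrict: "e (?r \<omega>) = e (\<lambda>j. i j \<omega>)" for \<omega>
    unfolding e_def by (subst sgd_cong[of k "?r \<omega>" "\<lambda>j. i j \<omega>"]) (auto simp: K_def)
  \<comment> \<open>Every update subtracts a multiple of a row.\<close>
  have row_space: "sgd \<eta> A y x1 h l \<in> row_space A" for h l
    using x1 by (induction \<eta> A y x1 h l rule: sgd.induct)
      (auto simp: Let_def intro!: subspace_diff[OF subspace_row_space] subspace_scale[OF subspace_row_space] row_in_row_space)
  have step: "(norm (sgd \<eta> A y x1 (\<lambda>j. i j \<omega>) (Suc k) - u))\<^sup>2 = g (i k \<omega>) (?r \<omega>)" for \<omega>
  proof -
    \<comment> \<open>The recursion equation of \<open>sgd\<close> applies only at
      \<open>Suc (Suc _)\<close>, so the predecessor of \<open>k\<close> has to be exposed.\<close>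
    obtain k' where k': "k = Suc k'" using k by (cases k) auto
    show ?thesis
      unfolding g_def e_restrict unfolding e_def k'
      by (simp add: Let_def s_def matrix_mult_component_row inner_diff_right algebra_simps)
  qed
  have "E (Suc k) = (\<Sum>j\<in>UNIV. expectation (\<lambda>\<omega>. g j (?r \<omega>))) / CARD('n)"
    unfolding E_def step using k
    by (intro expectation_fresh_uniform[OF indep unif]) (auto simp: K_def)
  also have "(\<Sum>j\<in>UNIV. expectation (\<lambda>\<omega>. g j (?r \<omega>))) = expectation (\<lambda>\<omega>. \<Sum>j\<in>UNIV. g j (?r \<omega>))"
    using int by (subst Bochner_Integration.integral_sum) auto
  also have "\<dots> \<le> expectation (\<lambda>\<omega>. (CARD('n) - \<eta> k * \<sigma>\<^sup>2) * (norm (e (?r \<omega>)))\<^sup>2 + (\<eta> k)\<^sup>2 * R * (norm s)\<^sup>2)"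
  proof (rule integral_mono)
    show "integrable M (\<lambda>\<omega>. \<Sum>j\<in>UNIV. g j (?r \<omega>))" by (rule int)
    show "integrable M (\<lambda>\<omega>. (CARD('n) - \<eta> k * \<sigma>\<^sup>2) * (norm (e (?r \<omega>)))\<^sup>2 + (\<eta> k)\<^sup>2 * R * (norm s)\<^sup>2)"
      by (rule int)
    fix \<omega>
    have "e (?r \<omega>) \<in> row_space A"
      unfolding e_def by (intro subspace_diff[OF subspace_row_space] row_space u)
    then have "(\<sigma> * norm (e (?r \<omega>)))\<^sup>2 \<le> (norm (A *v e (?r \<omega>)))\<^sup>2"
      using \<sigma> by (intro power_mono) auto
    then have "\<eta> k * (\<sigma>\<^sup>2 * (norm (e (?r \<omega>)))\<^sup>2) \<le> \<eta> k * (norm (A *v e (?r \<omega>)))\<^sup>2"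
      using \<eta> by (intro mult_left_mono) (auto simp: power_mult_distrib)
    moreover have "(\<Sum>j\<in>UNIV. g j (?r \<omega>)) \<le> CARD('n) * (norm (e (?r \<omega>)))\<^sup>2 - \<eta> k * (norm (A *v e (?r \<omega>)))\<^sup>2
        + (\<eta> k)\<^sup>2 * R * (norm s)\<^sup>2"
      unfolding g_def by (rule sum_sgd_step_le[OF s \<eta> R])
    ultimately show "(\<Sum>j\<in>UNIV. g j (?r \<omega>))
        \<le> (CARD('n) - \<eta> k * \<sigma>\<^sup>2) * (norm (e (?r \<omega>)))\<^sup>2 + (\<eta> k)\<^sup>2 * R * (norm s)\<^sup>2"
      by (simp add: algebra_simps)
  qed
  also have "\<dots> = (CARD('n) - \<eta> k * \<sigma>\<^sup>2) * E k + (\<eta> k)\<^sup>2 * R * (norm s)\<^sup>2"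
    using int[of "\<lambda>h. (norm (e h))\<^sup>2"]
    by (simp add: E_def e_restrict prob_space) (simp add: e_def)
  also have "((CARD('n) - \<eta> k * \<sigma>\<^sup>2) * E k + (\<eta> k)\<^sup>2 * R * (norm s)\<^sup>2) / CARD('n)
      = (1 - \<eta> k * \<sigma>\<^sup>2 / CARD('n)) * E k + (\<eta> k)\<^sup>2 * R / CARD('n) * (norm (y - A *v u))\<^sup>2"
    unfolding s_def by (simp add: add_divide_distrib diff_divide_distrib algebra_simps)
  finally show ?thesis
    by (simp add: divide_right_mono)
qed

text \<open>Each of the \<open>k\<close> summands is at least the last one,
  \<open>real k powr - \<alpha>\<close>.\<close>

lemma step_sum_ge:
  assumes "0 \<le> \<alpha>"
  shows "real k powr (1 - \<alpha>) \<le> (\<Sum>j<k. real (Suc j) powr - \<alpha>)"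
proof (cases "k = 0")
  case False
  have "(\<Sum>j<k. real k powr - \<alpha>) \<le> (\<Sum>j<k. real (Suc j) powr - \<alpha>)"
    using assms by (intro sum_mono powr_mono2') auto
  then show ?thesis using False by (simp add: powr_diff powr_minus field_simps)
qed simp

text \<open>The decay of the initial error has to survive division by the squared noise level, which
  is compensated by a power of the iteration number.\<close>

lemma poly_times_stretched_exp_tendsto_0:
  fixes D q C \<beta> :: real
  assumes "C > 0" "\<beta> > 0"
  shows "(\<lambda>k. D * real (Suc k) powr q * exp (- C * real k powr \<beta>)) \<longlonglongrightarrow> 0"
  using assms by real_asymp

lemma (in prob_space) integrable_sgd:
  fixes A :: "real^'m^'n" and i :: "nat \<Rightarrow> 'a \<Rightarrow> 'n" and f :: "real^'m \<Rightarrow> real"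
  assumes "\<And>k. 1 \<le> k \<Longrightarrow> i k \<in> M \<rightarrow>\<^sub>M count_space UNIV"
  shows "integrable M (\<lambda>\<omega>. f (sgd \<eta> A y x1 (\<lambda>j. i j \<omega>) k))"
proof -
  have "sgd \<eta> A y x1 (\<lambda>j. i j \<omega>) k = sgd \<eta> A y x1 (\<lambda>j\<in>{1..<k}. i j \<omega>) k" for \<omega>
    by (rule sgd_cong) auto
  then show ?thesis
    using integrable_finite_valued[of "{1..<k}" i "\<lambda>h. f (sgd \<eta> A y x1 h k)"] assms by simp
qed

text \<open>Unrolls \<open>sgd_error_step\<close>. \<open>C\<close> and \<open>b\<close> are fixed
  before \<open>y\<close>, \<open>u\<close> and \<open>k\<close>, so they serve all noise levels at
  once: the data enter the bound only through the two squared norms.\<close>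

lemma (in prob_space) sgd_mean_square_error:
  fixes A :: "real^'m^'n" and x1 :: "real^'m" and i :: "nat \<Rightarrow> 'a \<Rightarrow> 'n"
  assumes indep: "indep_vars (\<lambda>_. count_space UNIV) i {1..}"
    and unif: "\<And>k. 1 \<le> k \<Longrightarrow> distr M (count_space UNIV) (i k) = uniform_count_measure UNIV"
    and x1: "x1 \<in> row_space A"
    and \<alpha>: "0 < \<alpha>" "\<alpha> < 1" and c0: "0 < c0" "\<And>j. c0 * (norm (row j A))\<^sup>2 \<le> 1"
    and \<eta>: "\<And>j. 1 \<le> j \<Longrightarrow> \<eta> j = c0 * real j powr (- \<alpha>)"
  obtains C b where "C > 0" "b \<longlonglongrightarrow> 0"
    "\<And>y u k. \<lbrakk>u \<in> row_space A; (y - A *v u) v* A = 0\<rbrakk> \<Longrightarrow>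
       expectation (\<lambda>\<omega>. (norm (sgd \<eta> A y x1 (\<lambda>j. i j \<omega>) (Suc k) - u))\<^sup>2)
       \<le> (norm (x1 - u))\<^sup>2 * exp (- C * real k powr (1 - \<alpha>)) + (norm (y - A *v u))\<^sup>2 * b k"
proof -
  obtain \<sigma> where \<sigma>: "\<sigma> > 0" "\<And>v. v \<in> row_space A \<Longrightarrow> \<sigma> * norm v \<le> norm (A *v v)"
    by (rule bounded_below_on_row_space[of A]) blast
  define N where "N = real CARD('n)"
  have N: "N > 0" by (simp add: N_def)
  \<comment> \<open>The contraction rate \<open>\<sigma>\<^sup>2 / N\<close>, capped so that
    \<open>\<kappa> * \<eta> (Suc j) \<le> 1\<close> for all steps, which are at most
    \<open>c0\<close>.\<close>
  define \<kappa> where "\<kappa> = min (\<sigma>\<^sup>2 / N) (1 / c0)"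
  have \<kappa>: "\<kappa> > 0" "\<kappa> * c0 \<le> 1" "\<kappa> \<le> \<sigma>\<^sup>2 / N"
    using \<sigma>(1) N c0(1) by (auto simp: \<kappa>_def min_def field_simps)
  have \<eta>_bounds: "0 < \<eta> (Suc j)" "\<eta> (Suc j) \<le> c0" for j
  proof -
    have "real (Suc j) powr - \<alpha> \<le> 1 powr - \<alpha>"
      using \<alpha> by (intro powr_mono2') auto
    then show "0 < \<eta> (Suc j)" "\<eta> (Suc j) \<le> c0"
      using \<eta>[of "Suc j"] c0(1) by (auto simp: mult_left_le)
  qed
  define t where "t j = \<kappa> * \<eta> (Suc j)" for j
  \<comment> \<open>Normalised so that \<open>t j * e j\<close> is the noise coefficient
    \<open>(\<eta> (Suc j))\<^sup>2 / (c0 * N)\<close> of one step; \<open>e\<close> tends to 0 with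
    the step sizes.\<close>
  define e where "e j = \<eta> (Suc j) / (c0 * N * \<kappa>)" for j
  \<comment> \<open>Bounds the mean square error that a residual of norm one builds up from the
    start \<open>x1 = u\<close>.\<close>
  define b where "b = rec_nat 0 (\<lambda>k x. (1 - t k) * x + t k * e k)"
  have b: "b 0 = 0" "b (Suc k) = (1 - t k) * b k + t k * e k" for k
    by (simp_all add: b_def)
  have t: "0 \<le> t j" "t j \<le> 1" for j
    using \<eta>_bounds[of j] \<kappa> order_trans[OF mult_left_mono[of "\<eta> (Suc j)" c0 \<kappa>], of 1] by (auto simp: t_def)
  have sum_t: "\<kappa> * c0 * real k powr (1 - \<alpha>) \<le> (\<Sum>j<k. t j)" for k
    using mult_left_mono[OF step_sum_ge[of \<alpha> k], of "\<kappa> * c0"] \<alpha> \<kappa> c0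
    by (simp add: t_def \<eta> sum_distrib_left mult.assoc)
  have "b \<longlonglongrightarrow> 0"
  proof (rule contraction_tendsto_0[where t = t and e = e])
    show "0 \<le> e k" for k
      using \<eta>_bounds[of k] c0 N \<kappa> by (simp add: e_def)
    have "(\<lambda>k. real (Suc k) powr - \<alpha>) \<longlonglongrightarrow> 0"
      using \<alpha> by real_asymp
    then have "(\<lambda>k. c0 * real (Suc k) powr - \<alpha> / (c0 * N * \<kappa>)) \<longlonglongrightarrow> c0 * 0 / (c0 * N * \<kappa>)"
      using c0 N \<kappa> by (intro tendsto_divide tendsto_mult tendsto_const) auto
    then show "e \<longlonglongrightarrow> 0"
      by (simp add: e_def[abs_def] \<eta>)
    have "filterlim (\<lambda>k. \<kappa> * c0 * real k powr (1 - \<alpha>)) at_top sequentially"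
      using \<kappa> c0 \<alpha> by real_asymp
    then show "filterlim (\<lambda>k. \<Sum>j<k. t j) at_top sequentially"
      by (rule filterlim_at_top_mono) (simp add: sum_t)
  qed (rule b t)+
  moreover have "expectation (\<lambda>\<omega>. (norm (sgd \<eta> A y x1 (\<lambda>j. i j \<omega>) (Suc k) - u))\<^sup>2)
       \<le> (norm (x1 - u))\<^sup>2 * exp (- (\<kappa> * c0) * real k powr (1 - \<alpha>)) + (norm (y - A *v u))\<^sup>2 * b k"
    if u: "u \<in> row_space A" and ls: "(y - A *v u) v* A = 0" for y u k
  proof -
    define a where "a k = expectation (\<lambda>\<omega>. (norm (sgd \<eta> A y x1 (\<lambda>j. i j \<omega>) (Suc k) - u))\<^sup>2)" for k
    have "a k \<le> (norm (x1 - u))\<^sup>2 * (\<Prod>j<k. 1 - t j) + (norm (y - A *v u))\<^sup>2 * b k"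
    proof (rule unroll_contraction[OF _ t(2) b])
      show "a 0 \<le> (norm (x1 - u))\<^sup>2"
        by (simp add: a_def prob_space)
      fix k
      \<comment> \<open>\<open>1 / c0\<close> takes the place of \<open>R\<close>, so that
        \<open>\<eta> (Suc k) * R \<le> 1\<close> follows from
        \<open>\<eta> (Suc k) \<le> c0\<close>.\<close>
      have row: "(norm (row j A))\<^sup>2 \<le> 1 / c0" for j
        using c0(1) c0(2)[of j] by (simp add: field_simps)
      have "a (Suc k) \<le> (1 - \<eta> (Suc k) * \<sigma>\<^sup>2 / N) * a k
          + (\<eta> (Suc k))\<^sup>2 * (1 / c0) / N * (norm (y - A *v u))\<^sup>2"
        unfolding a_def N_def using \<eta>_bounds[of k] c0(1) \<sigma>
        by (intro sgd_error_step indep unif ls u x1 row) auto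
      also have "\<dots> \<le> (1 - t k) * a k + (\<eta> (Suc k))\<^sup>2 * (1 / c0) / N * (norm (y - A *v u))\<^sup>2"
      proof (intro add_right_mono mult_right_mono)
        show "0 \<le> a k" by (simp add: a_def)
        show "1 - \<eta> (Suc k) * \<sigma>\<^sup>2 / N \<le> 1 - t k"
          using mult_left_mono[OF \<kappa>(3), of "\<eta> (Suc k)"] \<eta>_bounds[of k] by (simp add: t_def mult_ac)
      qed
      also have "(\<eta> (Suc k))\<^sup>2 * (1 / c0) / N = t k * e k"
        using \<kappa> N c0 by (simp add: t_def e_def power2_eq_square)
      finally show "a (Suc k) \<le> (1 - t k) * a k + (norm (y - A *v u))\<^sup>2 * (t k * e k)"
        by (simp only: mult.commute)
    qed
    also have "(\<Prod>j<k. 1 - t j) \<le> exp (- (\<Sum>j<k. t j))"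
      using t by (intro prod_one_minus_le_exp) auto
    also have "\<dots> \<le> exp (- (\<kappa> * c0) * real k powr (1 - \<alpha>))"
      using sum_t[of k] by simp
    finally show ?thesis
      by (simp add: a_def mult_left_mono)
  qed
  ultimately show ?thesis
    using that[of "\<kappa> * c0" b] \<kappa> c0 by auto
qed

section \<open>Stopping by the discrepancy principle\<close>

text \<open>Pythagoras: the normal equation makes \<open>y - A *v u\<close> orthogonal to
  \<open>A *v (u - z)\<close>. With an exact solution as \<open>z\<close>, the residual for noisy
  data is bounded by the noise level.\<close>

lemma norm_residual_le:
  fixes A :: "real^'m^'n"
  assumes "(y - A *v u) v* A = 0"
  shows "norm (y - A *v u) \<le> norm (y - A *v z)"
proof -
  have "orthogonal (y - A *v u) (A *v (u - z))"
    unfolding orthogonal_def dot_lmul_matrix[symmetric] assms by simp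
  then have "(norm ((y - A *v u) + A *v (u - z)))\<^sup>2 = (norm (y - A *v u))\<^sup>2 + (norm (A *v (u - z)))\<^sup>2"
    by (rule norm_add_Pythagorean)
  then have "(norm (y - A *v u))\<^sup>2 \<le> (norm (y - A *v z))\<^sup>2"
    by (simp add: matrix_vector_mult_diff_distrib)
  then show ?thesis by (rule power2_le_imp_le) simp
qed

theorem theorem1p1:
  fixes A :: "real^'m^'n" and B :: "real^'m^'m"
    and ydag :: "real^'n" and yd :: "real \<Rightarrow> real^'n"
    and xdag x1 w :: "real^'m"
    and \<eta> :: "nat \<Rightarrow> real" and c0 \<alpha> p r \<tau> \<tau>s c :: real
    and M :: "'a measure" and i :: "nat \<Rightarrow> 'a \<Rightarrow> 'n"
  assumes "A \<noteq> 0"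
    and "B = (1 / real CARD('n)) *\<^sub>R (transpose A ** A)"
    and "ydag \<in> range (\<lambda>x. A *v x)"
    and "min_norm_solution A ydag xdag"
    and "\<And>\<delta>. \<delta> > 0 \<Longrightarrow> norm (yd \<delta> - ydag) = \<delta>"
    and "prob_space M"
    and "prob_space.indep_vars M (\<lambda>_. count_space UNIV) i {1..}"
    and "\<And>k. 1 \<le> k \<Longrightarrow> distr M (count_space UNIV) (i k) = uniform_count_measure UNIV"
    and "x1 = 0"
    and "0 < \<alpha>" and "\<alpha> < 1"
    and "0 < c0" and "c0 \<le> inverse (Max (range (\<lambda>j. (norm (row j A))\<^sup>2)))"
    and "\<And>j. 1 \<le> j \<Longrightarrow> \<eta> j = c0 * real j powr (- \<alpha>)"
    and "p > 0" and "xdag - x1 = matrix_powr B p *v w"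
    and "0 < r" and "r < 1"
    and "\<tau> > \<tau>s" and "\<tau>s > 1"
    and "c = stop_const CARD('n) p \<alpha> r \<tau>s (src_const p \<alpha> c0 w)"
  shows "((\<lambda>\<delta>. measure M {\<omega> \<in> space M.
            ereal_of_enat (discrepancy_index A (yd \<delta>) \<tau> \<delta>
                (sgd \<eta> A (yd \<delta>) x1 (\<lambda>k. i k \<omega>)))
              \<le> ereal (c * \<delta> powr (- 2 / ((1 - \<alpha>) * (min (2 * p) r + 1))))})
          \<longlongrightarrow> 1) (at_right 0)"
proof -
  interpret prob_space M by fact
  note noise = assms(5) and indep = assms(7) and unif = assms(8) and x1 = assms(9)
    and \<alpha> = assms(10,11) and c0 = assms(12,13) and \<eta> = assms(14)
  have meas: "i k \<in> M \<rightarrow>\<^sub>M count_space UNIV" if "1 \<le> k" for k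
    using indep that unfolding indep_vars_def by auto
  have c0_row: "c0 * (norm (row j A))\<^sup>2 \<le> 1" for j
  proof -
    let ?R = "Max (range (\<lambda>j. (norm (row j A))\<^sup>2))"
    have "(norm (row j A))\<^sup>2 \<le> ?R"
      by (rule Max_ge) auto
    \<comment> \<open>\<open>inverse\<close> preserves signs and \<open>inverse 0 = 0\<close>, so
      \<open>0 < c0 \<le> inverse ?R\<close> forces positivity.\<close>
    moreover have "?R > 0"
      using c0 by (metis inverse_positive_iff_positive less_le_trans)
    ultimately show ?thesis
      using c0 mult_mono[of c0 "inverse ?R" "(norm (row j A))\<^sup>2" ?R] by simp
  qed
  have "x1 \<in> row_space A"
    by (simp add: x1 subspace_0 subspace_row_space)
  then obtain C b where C: "C > 0" and b: "b \<longlonglongrightarrow> 0"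
    and err: "\<And>y u k. \<lbrakk>u \<in> row_space A; (y - A *v u) v* A = 0\<rbrakk> \<Longrightarrow>
       expectation (\<lambda>\<omega>. (norm (sgd \<eta> A y x1 (\<lambda>j. i j \<omega>) (Suc k) - u))\<^sup>2)
       \<le> (norm (x1 - u))\<^sup>2 * exp (- C * real k powr (1 - \<alpha>)) + (norm (y - A *v u))\<^sup>2 * b k"
    using sgd_mean_square_error[OF indep unif _ \<alpha> c0(1) c0_row \<eta>] by blast
  obtain \<sigma> where \<sigma>: "\<sigma> > 0" "\<And>v. v \<in> row_space A \<Longrightarrow> \<sigma> * norm v \<le> norm (A *v v)"
    by (rule bounded_below_on_row_space[of A]) blast
  obtain L where L: "L > 0" "\<And>v. norm (A *v v) \<le> L * norm v"
    using bounded_linear.pos_bounded[OF matrix_vector_mul_bounded_linear[of A]]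
    by (auto simp: mult.commute)
  have "\<exists>u. u \<in> row_space A \<and> (yd \<delta> - A *v u) v* A = 0" for \<delta>
    using least_squares_solution by metis
  then obtain u where u: "\<And>\<delta>. u \<delta> \<in> row_space A" "\<And>\<delta>. (yd \<delta> - A *v u \<delta>) v* A = 0"
    by metis
  have res: "norm (yd \<delta> - A *v u \<delta>) \<le> \<delta>" if "\<delta> > 0" for \<delta>
    using norm_residual_le[OF u(2)] noise[OF that] assms(3) by (metis imageE)
  \<comment> \<open>Bounds the initial error uniformly in \<delta> < 1:
    \<open>A *v u \<delta>\<close> differs from \<open>ydag\<close> by the noise and the residual,
    each of norm at most 1.\<close>
  define D where "D = ((norm ydag + 2) / \<sigma>)\<^sup>2"
  have D: "(norm (x1 - u \<delta>))\<^sup>2 \<le> D" if "0 < \<delta>" "\<delta> < 1" for \<delta>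
  proof -
    have "\<sigma> * norm (u \<delta>) \<le> norm (A *v u \<delta>)"
      by (rule \<sigma>(2)[OF u(1)])
    also have "\<dots> = norm (ydag + (yd \<delta> - ydag) - (yd \<delta> - A *v u \<delta>))"
      by simp
    also have "\<dots> \<le> norm ydag + norm (yd \<delta> - ydag) + norm (yd \<delta> - A *v u \<delta>)"
      by (intro norm_triangle_le_diff add_right_mono norm_triangle_ineq)
    also have "\<dots> \<le> norm ydag + 2"
      using noise[of \<delta>] res[of \<delta>] that by simp
    finally have "norm (u \<delta>) \<le> (norm ydag + 2) / \<sigma>"
      using \<sigma>(1) by (simp add: field_simps)
    then show ?thesis
      by (simp add: D_def x1 power_mono)
  qed

  define \<gamma> where "\<gamma> = 2 / ((1 - \<alpha>) * (min (2 * p) r + 1))"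
  have \<gamma>: "\<gamma> > 0" "- 2 / ((1 - \<alpha>) * (min (2 * p) r + 1)) = - \<gamma>"
    using assms \<alpha> by (auto simp: \<gamma>_def min_def)
  \<comment> \<open>The \<open>powr\<close> term in \<open>stop_const\<close> is nonnegative, and 0
    when \<open>w = 0\<close>.\<close>
  have c: "c \<ge> 2"
    using assms(21) by (simp add: stop_const_def)
  \<comment> \<open>\<open>Suc (K \<delta>)\<close> is the last iterate number within the claimed
    bound; the shift by one matches \<open>err\<close>, which speaks of iterate
    \<open>Suc k\<close>.\<close>
  define K where "K \<delta> = nat \<lfloor>c * \<delta> powr - \<gamma>\<rfloor> - 1" for \<delta>
  \<comment> \<open>For the second bound let \<open>X = \<delta> powr - \<gamma>\<close>, which is
    at least 1: the floor exceeds \<open>c * X - 1 \<ge> 2 * X - 1 \<ge> X\<close>.\<close>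
  have K: "real (Suc (K \<delta>)) \<le> c * \<delta> powr - \<gamma>" "\<delta> powr - \<gamma> \<le> real (Suc (K \<delta>))"
    if "0 < \<delta>" "\<delta> < 1" for \<delta>
  proof -
    have "1 \<le> \<delta> powr - \<gamma>"
      using that \<gamma> powr_mono2'[of "- \<gamma>" \<delta> 1] by simp
    moreover have "2 * \<delta> powr - \<gamma> \<le> c * \<delta> powr - \<gamma>"
      using c by (intro mult_right_mono) auto
    moreover from calculation have "real (Suc (K \<delta>)) = of_int \<lfloor>c * \<delta> powr - \<gamma>\<rfloor>"
      unfolding K_def by (subst Suc_diff_1) (auto simp: le_floor_iff less_floor_iff zero_less_nat_eq)
    ultimately show "real (Suc (K \<delta>)) \<le> c * \<delta> powr - \<gamma>" "\<delta> powr - \<gamma> \<le> real (Suc (K \<delta>))"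
      by linarith+
  qed
  have small: "\<forall>\<^sub>F \<delta> in at_right 0. 0 < \<delta> \<and> \<delta> < (1::real)"
    by (auto simp: eventually_at_right_field intro: exI[of _ 1])
  have "filterlim (\<lambda>\<delta>. \<delta> powr - \<gamma> - 1) at_top (at_right 0)"
    using \<gamma>(1) by real_asymp
  then have "filterlim (\<lambda>\<delta>. real (K \<delta>)) at_top (at_right 0)"
    by (rule filterlim_at_top_mono) (use small in \<open>eventually_elim, use K in force\<close>)
  then have K_lim: "filterlim K sequentially (at_right 0)"
    by (simp add: filterlim_sequentially_iff_filterlim_real)

  \<comment> \<open>\<open>F (K \<delta>) * \<delta>\<^sup>2\<close> will bound the mean square
    error. The absolute value allows the squared residual in front of \<open>b k\<close> to be
    replaced by the larger \<open>\<delta>\<^sup>2\<close>.\<close>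
  define F where "F k = D * real (Suc k) powr (2 / \<gamma>) * exp (- C * real k powr (1 - \<alpha>)) + \<bar>b k\<bar>" for k
  have "F \<longlonglongrightarrow> 0 + 0"
    unfolding F_def using b C \<alpha>
    by (intro tendsto_add poly_times_stretched_exp_tendsto_0 tendsto_rabs_zero) auto
  \<comment> \<open>Chosen so that an error below \<open>\<theta> * \<delta>\<close> gives a
    discrepancy of at most
    \<open>L * (\<theta> * \<delta>) + \<delta> = \<tau> * \<delta>\<close>.\<close>
  define \<theta> where "\<theta> = (\<tau> - 1) / L"
  have \<theta>: "\<theta> > 0" using assms L by (simp add: \<theta>_def)
  define G where "G \<delta> = {\<omega> \<in> space M. \<exists>k\<ge>1. real k \<le> c * \<delta> powr - \<gamma> \<and>
    norm (A *v sgd \<eta> A (yd \<delta>) x1 (\<lambda>k. i k \<omega>) k - yd \<delta>) \<le> \<tau> * \<delta>}" for \<delta>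
  have lower: "1 - F (K \<delta>) / \<theta>\<^sup>2 \<le> prob (G \<delta>)" if \<delta>: "0 < \<delta>" "\<delta> < 1" for \<delta>
  proof -
    let ?x = "\<lambda>\<omega>. sgd \<eta> A (yd \<delta>) x1 (\<lambda>k. i k \<omega>)"
    let ?e = "\<lambda>\<omega>. (norm (?x \<omega> (Suc (K \<delta>)) - u \<delta>))\<^sup>2"
    have [measurable]: "(\<lambda>\<omega>. norm (A *v ?x \<omega> k - yd \<delta>)) \<in> borel_measurable M" for k
      by (intro borel_measurable_integrable integrable_sgd meas)
    have G[measurable]: "G \<delta> \<in> events"
      unfolding G_def by measurable
    have int: "integrable M ?e"
      by (intro integrable_sgd meas)
    have [measurable]: "?e \<in> borel_measurable M"
      using int by (rule borel_measurable_integrable)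
    have "prob {\<omega> \<in> space M. ?e \<omega> \<ge> (\<theta> * \<delta>)\<^sup>2} \<le> expectation ?e / (\<theta> * \<delta>)\<^sup>2"
      using \<theta> \<delta> int by (intro integral_Markov_inequality_measure[where A = "{}"]) auto
    also have "\<dots> \<le> (F (K \<delta>) * \<delta>\<^sup>2) / (\<theta> * \<delta>)\<^sup>2"
    proof (rule divide_right_mono)
      let ?E = "exp (- C * real (K \<delta>) powr (1 - \<alpha>))"
      have "expectation ?e \<le> (norm (x1 - u \<delta>))\<^sup>2 * ?E + (norm (yd \<delta> - A *v u \<delta>))\<^sup>2 * b (K \<delta>)"
        by (rule err[OF u])
      also have "\<dots> \<le> D * ?E + \<delta>\<^sup>2 * \<bar>b (K \<delta>)\<bar>"
        using D[OF \<delta>] res[OF \<delta>(1)]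
        by (intro add_mono mult_right_mono order_trans[OF mult_left_mono[OF abs_ge_self] mult_right_mono])
           (auto intro: power_mono)
      \<comment> \<open>The inserted factor is at least 1, since \<open>Suc (K \<delta>)\<close> is
        at least \<open>\<delta> powr - \<gamma>\<close>; it supplies the missing
        \<open>\<delta>\<^sup>2\<close>.\<close>
      also have "D * ?E \<le> D * ?E * ((real (Suc (K \<delta>)) powr (2 / \<gamma>)) * \<delta>\<^sup>2)"
      proof -
        have "(\<delta> powr - \<gamma>) powr (2 / \<gamma>) = \<delta> powr - 2"
          using \<gamma>(1) by (simp add: powr_powr)
        then have "1 = (\<delta> powr - \<gamma>) powr (2 / \<gamma>) * \<delta>\<^sup>2"
          using \<delta> by (simp add: powr_minus powr_numeral)
        also have "\<dots> \<le> real (Suc (K \<delta>)) powr (2 / \<gamma>) * \<delta>\<^sup>2"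
          using K(2)[OF \<delta>] \<gamma>(1) by (intro mult_right_mono powr_mono2) auto
        finally show ?thesis
          using mult_left_mono[of 1 _ "D * ?E"] by (simp add: D_def)
      qed
      finally show "expectation ?e \<le> F (K \<delta>) * \<delta>\<^sup>2"
        by (simp add: F_def algebra_simps)
    qed simp
    also have "\<dots> = F (K \<delta>) / \<theta>\<^sup>2"
      using \<delta> by (simp add: power_mult_distrib)
    finally have "1 - F (K \<delta>) / \<theta>\<^sup>2 \<le> prob (space M - {\<omega> \<in> space M. ?e \<omega> \<ge> (\<theta> * \<delta>)\<^sup>2})"
      by (subst prob_compl) auto
    also have "\<dots> \<le> prob (G \<delta>)"
    \<comment> \<open>Off the Markov event the iterate \<open>Suc (K \<delta>)\<close> itself
      satisfies the discrepancy principle and so witnesses \<open>G \<delta>\<close>.\<close>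
    proof (rule finite_measure_mono[OF _ G], rule subsetI)
      fix \<omega> assume "\<omega> \<in> space M - {\<omega> \<in> space M. ?e \<omega> \<ge> (\<theta> * \<delta>)\<^sup>2}"
      then have \<omega>: "\<omega> \<in> space M" and sq: "?e \<omega> < (\<theta> * \<delta>)\<^sup>2" by auto
      have e: "norm (?x \<omega> (Suc (K \<delta>)) - u \<delta>) < \<theta> * \<delta>"
        by (rule power2_less_imp_less[OF sq]) (use \<theta> \<delta> in simp)
      have "norm (A *v ?x \<omega> (Suc (K \<delta>)) - yd \<delta>)
          = norm (A *v (?x \<omega> (Suc (K \<delta>)) - u \<delta>) - (yd \<delta> - A *v u \<delta>))"
        by (simp add: matrix_vector_mult_diff_distrib)
      also have "\<dots> \<le> L * norm (?x \<omega> (Suc (K \<delta>)) - u \<delta>) + \<delta>"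
        by (intro order_trans[OF norm_triangle_ineq4] add_mono L res \<delta>)
      also have "\<dots> \<le> L * (\<theta> * \<delta>) + \<delta>"
        using e L(1) by simp
      also have "\<dots> = \<tau> * \<delta>"
        using L(1) by (simp add: \<theta>_def field_simps)
      finally show "\<omega> \<in> G \<delta>"
        unfolding G_def using \<omega> K(1)[OF \<delta>] by (intro CollectI conjI exI[of _ "Suc (K \<delta>)"]) auto
    qed
    finally show ?thesis .
  qed
  have "((\<lambda>\<delta>. prob (G \<delta>)) \<longlongrightarrow> 1) (at_right 0)"
  proof (rule tendsto_sandwich)
    show "\<forall>\<^sub>F \<delta> in at_right 0. 1 - F (K \<delta>) / \<theta>\<^sup>2 \<le> prob (G \<delta>)"
      using small by eventually_elim (rule lower, auto)
    show "\<forall>\<^sub>F \<delta> in at_right 0. prob (G \<delta>) \<le> 1" by simp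
    have "((\<lambda>\<delta>. F (K \<delta>)) \<longlongrightarrow> 0) (at_right 0)"
      using filterlim_compose[OF \<open>F \<longlonglongrightarrow> 0 + 0\<close> K_lim] by simp
    then have "((\<lambda>\<delta>. 1 - F (K \<delta>) / \<theta>\<^sup>2) \<longlongrightarrow> 1 - 0 / \<theta>\<^sup>2) (at_right 0)"
      by (intro tendsto_diff tendsto_divide tendsto_const) (use \<theta> in auto)
    then show "((\<lambda>\<delta>. 1 - F (K \<delta>) / \<theta>\<^sup>2) \<longlongrightarrow> 1) (at_right 0)" by simp
  qed simp
  then show ?thesis
    unfolding G_def by (simp only: discrepancy_index_le_iff \<gamma>(2))
qed

end
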